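(* Let $X$ be a finite digital image, let $Y$ be a digital image, and let $f,g : X \to Y$ be strongly homotopic. Then $f$ and $g$ are homotopic by a punctuated homotopy.
   Context: A digital image is a set $X$ together with a symmetric, antireflexive adjacency relation on $X$. A function $f : X \to Y$ between digital images is continuous if whenever $x$ is adjacent to $x'$, the points $f(x)$ and $f(x')$ are adjacent or equal. For integers $a\le b$, $[a,b]_{\mathbb{Z}} = \{a,a+1,\dots,b\}$, a digital image in which $s,t$ are adjacent iff $|s-t|=1$. Let $k$ be a positive integer. A homotopy between continuous functions $f,g:X\to Y$ is a function $H : X \times [0,k]_{\mathbb{Z}} \to Y$ such that $H(x,0)=f(x)$ and $H(x,k)=g(x)$ for all $x$; for each fixed $x$ the function $t \mapsto H(x,t)$ is continuous; and for each fixed $t$ the function $x \mapsto H(x,t)$ is continuous. A homotopy $H$ is punctuated if for each $t \in [0,k-1]_{\mathbb{Z}}$ there is some $x_t \in X$ such that $H(x,t)=H(x,t+1)$ for all $x \ne x_t$. On $X \times [0,k]_{\mathbb{Z}}$ the adjacency $\mathrm{NP}_2$ is: two distinct points $(x,t)$, $(x',t')$ are adjacent iff $x,x'$ are adjacent or equal and $t,t'$ are adjacent or equal. A strong homotopy between $f$ and $g$ is a function $H : X\times[0,k]_{\mathbb{Z}}\to Y$ (for some positive integer $k$) with $H(\cdot,0)=f$, $H(\cdot,k)=g$ that is continuous with respect to $\mathrm{NP}_2$ on the domain and the given adjacency on $Y$; then $f$ and $g$ are called strongly homotopic.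
   Formalization: The finite digital image X is additionally assumed nonempty: for empty X the empty functions are strongly homotopic, but no punctuated homotopy exists, since one requires a point x_t in X for each t. *)

theory Defs
  imports Main "HOL-Library.FuncSet"
begin

definition digital_image :: "'a set \<Rightarrow> 'a rel \<Rightarrow> bool" where
  "digital_image X A \<longleftrightarrow> A \<subseteq> X \<times> X \<and> sym A \<and> irrefl A"

definition digitally_continuous ::
  "'a set \<Rightarrow> 'a rel \<Rightarrow> 'b set \<Rightarrow> 'b rel \<Rightarrow> ('a \<Rightarrow> 'b) \<Rightarrow> bool" where
  "digitally_continuous X A Y B f \<longleftrightarrow>
     f \<in> X \<rightarrow> Y \<and>
     (\<forall>x\<in>X. \<forall>x'\<in>X. (x, x') \<in> A \<longrightarrow> (f x, f x') \<in> B \<or> f x = f x')"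

definition interval_adj :: "int \<Rightarrow> int \<Rightarrow> int rel" where
  "interval_adj a b = {(s, t). s \<in> {a..b} \<and> t \<in> {a..b} \<and> \<bar>s - t\<bar> = 1}"

definition NP2_adj :: "'a set \<Rightarrow> 'a rel \<Rightarrow> 'b set \<Rightarrow> 'b rel \<Rightarrow> ('a \<times> 'b) rel" where
  "NP2_adj X A T C =
     {((x, t), (x', t')). x \<in> X \<and> x' \<in> X \<and> t \<in> T \<and> t' \<in> T \<and> (x, t) \<noteq> (x', t') \<and>
        ((x, x') \<in> A \<or> x = x') \<and> ((t, t') \<in> C \<or> t = t')}"

text \<open>
  Functions between images are total functions on the ambient types; only their values on the
  carriers matter, so the boundary conditions of a homotopy are imposed on the carrier only.
\<close>

definition is_homotopy ::
  "'a set \<Rightarrow> 'a rel \<Rightarrow> 'b set \<Rightarrow> 'b rel \<Rightarrow> ('a \<Rightarrow> 'b) \<Rightarrow> ('a \<Rightarrow> 'b) \<Rightarrow> int \<Rightarrow> ('a \<times> int \<Rightarrow> 'b) \<Rightarrow> bool"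
  where
  "is_homotopy X A Y B f g k H \<longleftrightarrow>
     k > 0 \<and>
     digitally_continuous X A Y B f \<and> digitally_continuous X A Y B g \<and>
     H \<in> X \<times> {0..k} \<rightarrow> Y \<and>
     (\<forall>x\<in>X. H (x, 0) = f x \<and> H (x, k) = g x) \<and>
     (\<forall>x\<in>X. digitally_continuous {0..k} (interval_adj 0 k) Y B (\<lambda>t. H (x, t))) \<and>
     (\<forall>t\<in>{0..k}. digitally_continuous X A Y B (\<lambda>x. H (x, t)))"

text \<open>The exceptional point is required to lie in the carrier, so nothing is punctuated on an
  empty image when \<open>k > 0\<close>.\<close>

definition punctuated :: "'a set \<Rightarrow> int \<Rightarrow> ('a \<times> int \<Rightarrow> 'b) \<Rightarrow> bool" where
  "punctuated X k H \<longleftrightarrow>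
     (\<forall>t\<in>{0..k - 1}. \<exists>x\<^sub>t\<in>X. \<forall>x\<in>X. x \<noteq> x\<^sub>t \<longrightarrow> H (x, t) = H (x, t + 1))"

definition is_strong_homotopy ::
  "'a set \<Rightarrow> 'a rel \<Rightarrow> 'b set \<Rightarrow> 'b rel \<Rightarrow> ('a \<Rightarrow> 'b) \<Rightarrow> ('a \<Rightarrow> 'b) \<Rightarrow> int \<Rightarrow> ('a \<times> int \<Rightarrow> 'b) \<Rightarrow> bool"
  where
  "is_strong_homotopy X A Y B f g k H \<longleftrightarrow>
     k > 0 \<and>
     (\<forall>x\<in>X. H (x, 0) = f x \<and> H (x, k) = g x) \<and>
     digitally_continuous (X \<times> {0..k}) (NP2_adj X A {0..k} (interval_adj 0 k)) Y B H"

definition strongly_homotopic ::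
  "'a set \<Rightarrow> 'a rel \<Rightarrow> 'b set \<Rightarrow> 'b rel \<Rightarrow> ('a \<Rightarrow> 'b) \<Rightarrow> ('a \<Rightarrow> 'b) \<Rightarrow> bool" where
  "strongly_homotopic X A Y B f g \<longleftrightarrow> (\<exists>k H. is_strong_homotopy X A Y B f g k H)"

end

theory Submission
  imports Defs
begin

text \<open>
  Split every time step of the strong homotopy \<open>H\<close> into \<open>n = card X\<close> steps that move one point
  each. With a bijection \<open>c\<close> from \<open>X\<close> to \<open>{0..<n}\<close>, the point \<open>x\<close> is at time \<open>t\<close> in the position
  \<open>H (x, (t + c x) div n)\<close>. Local times of two points differ by at most one, so \<open>NP\<^sub>2\<close>-continuity of
  \<open>H\<close> gives continuity of each stage; and only the point with \<open>n dvd t + 1 + c x\<close> moves between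
  \<open>t\<close> and \<open>t + 1\<close>.
\<close>

text \<open>\<open>NP2_adj\<close> relates distinct points only, so a coincident pair is settled by
  reflexivity. Allowing equality in both coordinates lets one fact serve stages with
  \<open>x\<close> fixed and stages with \<open>t\<close> fixed.\<close>

lemma is_strong_homotopy_close:
  assumes "is_strong_homotopy X A Y B f g k H"
    and "x \<in> X" "x' \<in> X" "(x, x') \<in> A \<or> x = x'"
    and "s \<in> {0..k}" "s' \<in> {0..k}" "\<bar>s - s'\<bar> \<le> 1"
  shows "(H (x, s), H (x', s')) \<in> B \<or> H (x, s) = H (x', s')"
proof (cases "(x, s) = (x', s')")
  case False
  have "(s, s') \<in> interval_adj 0 k \<or> s = s'"
    using assms(5-7) by (auto simp: interval_adj_def)
  then have "((x, s), (x', s')) \<in> NP2_adj X A {0..k} (interval_adj 0 k)"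
    using assms(2-6) False by (auto simp: NP2_adj_def)
  then show ?thesis
    using assms(1-3,5,6) unfolding is_strong_homotopy_def digitally_continuous_def by blast
qed simp

text \<open>Division by \<open>n\<close> is monotone, and adding \<open>n\<close> raises the
  quotient by exactly one.\<close>

lemma div_shift_close:
  fixes n a b :: int
  assumes "0 < n" "\<bar>a - b\<bar> \<le> n"
  shows "\<bar>a div n - b div n\<bar> \<le> 1"
proof -
  have "a div n \<le> (b + n) div n" "b div n \<le> (a + n) div n"
    using assms by (intro zdiv_mono1; linarith)+
  moreover have "(b + n) div n = b div n + 1" "(a + n) div n = a div n + 1"
    using assms(1) by (auto simp: div_add_self2)
  ultimately show ?thesis
    by linarith
qed

text \<open>The quotient can jump only from remainder \<open>n - 1\<close>; otherwise
  \<open>a mod n + 1\<close> is still a valid remainder for the same quotient.\<close>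

lemma div_add_one_eq:
  fixes n a :: int
  assumes "0 < n" "\<not> n dvd a + 1"
  shows "(a + 1) div n = a div n"
proof (rule int_div_pos_eq)
  have "a mod n + 1 \<noteq> n"
    using assms(2) by (metis dvd_refl mod_add_left_eq dvd_eq_mod_eq_0)
  then show "a mod n + 1 < n"
    using pos_mod_bound[OF assms(1), of a] by linarith
qed (use assms(1) in \<open>simp_all add: pos_mod_sign\<close>)

theorem theorem14:
  fixes X :: "'a set" and A :: "'a rel"
    and Y :: "'b set" and B :: "'b rel"
    and f g :: "'a \<Rightarrow> 'b"
  assumes "digital_image X A" and "finite X" and "X \<noteq> {}"
    and "digital_image Y B"
    and "f \<in> X \<rightarrow> Y" and "g \<in> X \<rightarrow> Y"
    and "strongly_homotopic X A Y B f g"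
  shows "\<exists>k H. is_homotopy X A Y B f g k H \<and> punctuated X k H"
proof -
  obtain k H where H: "is_strong_homotopy X A Y B f g k H"
    using assms(7) unfolding strongly_homotopic_def by blast
  then have k: "k > 0" and ends: "\<And>x. x \<in> X \<Longrightarrow> H (x, 0) = f x \<and> H (x, k) = g x"
    and HY: "\<And>x s. x \<in> X \<Longrightarrow> s \<in> {0..k} \<Longrightarrow> H (x, s) \<in> Y"
    unfolding is_strong_homotopy_def digitally_continuous_def by auto
  note close = is_strong_homotopy_close[OF H]
  define n where "n = int (card X)"
  have n: "n > 0"
    using assms(2,3) by (simp add: n_def card_gt_0_iff)
  obtain h where h: "bij_betw h X {0..<card X}"
    using ex_bij_betw_finite_nat[OF assms(2)] by blast
  define c where "c x = int (h x)" for x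
  have c: "0 \<le> c x \<and> c x < n" if "x \<in> X" for x
    using bij_betwE[OF h] that by (auto simp: c_def n_def)
  have c_inj: "c x = c y \<Longrightarrow> x = y" if "x \<in> X" "y \<in> X" for x y
    using bij_betw_imp_inj_on[OF h] that by (auto simp: c_def dest: inj_onD)
  have c_surj: "\<exists>x\<in>X. c x = i" if "0 \<le> i" "i < n" for i
  proof -
    have "nat i \<in> h ` X"
      using bij_betw_imp_surj_on[OF h] that by (auto simp: n_def)
    then obtain x where "x \<in> X" "nat i = h x"
      by blast
    then show ?thesis
      using that(1) by (intro bexI[of _ x]) (simp_all add: c_def flip: \<open>nat i = h x\<close>)
  qed
  define p where "p x t = (t + c x) div n" for x t
  \<comment> \<open>Since \<open>0 \<le> c x < n\<close>, the offset is lost in the division at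
    multiples of \<open>n\<close>, so all local times agree at both ends.\<close>
  have p_start: "p x 0 = 0" and p_end: "p x (k * n) = k" if "x \<in> X" for x
    using c[OF that] n by (simp_all add: p_def)
  \<comment> \<open>Local time is monotone in \<open>t\<close>, hence stays between its end values,
    where the continuity of \<open>H\<close> applies.\<close>
  have p_range: "p x t \<in> {0..k}" if "x \<in> X" "t \<in> {0..k * n}" for x t
  proof -
    have "p x 0 \<le> p x t" "p x t \<le> p x (k * n)"
      using that(2) n unfolding p_def by (intro zdiv_mono1; simp)+
    then show ?thesis
      using p_start p_end that(1) by simp
  qed
  have p_time: "\<bar>p x s - p x t\<bar> \<le> 1" if "\<bar>s - t\<bar> \<le> 1" for x s t
    unfolding p_def using that n by (intro div_shift_close) linarith+
  \<comment> \<open>Two offsets in \<open>{0..<n}\<close> differ by less than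
    \<open>n\<close>.\<close>
  have p_space: "\<bar>p x t - p y t\<bar> \<le> 1" if "x \<in> X" "y \<in> X" for x y t
    unfolding p_def using c[OF that(1)] c[OF that(2)] n by (intro div_shift_close) linarith+
  define G where "G = (\<lambda>(x, t). H (x, p x t))"
  \<comment> \<open>The end maps inherit continuity from the slices of \<open>H\<close> at times 0
    and \<open>k\<close>.\<close>
  have "digitally_continuous X A Y B f"
    unfolding digitally_continuous_def
    using assms(5) close[where s = 0 and s' = 0] ends k by auto
  moreover have "digitally_continuous X A Y B g"
    unfolding digitally_continuous_def
    using assms(6) close[where s = k and s' = k] ends k by auto
  moreover have "G \<in> X \<times> {0..k * n} \<rightarrow> Y"
    using HY p_range by (auto simp: G_def)
  moreover have "digitally_continuous {0..k * n} (interval_adj 0 (k * n)) Y B (\<lambda>t. G (x, t))"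
    if "x \<in> X" for x
    unfolding digitally_continuous_def
  proof (intro conjI ballI impI)
    show "(\<lambda>t. G (x, t)) \<in> {0..k * n} \<rightarrow> Y"
      using HY p_range that by (auto simp: G_def)
    fix s t assume "s \<in> {0..k * n}" "t \<in> {0..k * n}" "(s, t) \<in> interval_adj 0 (k * n)"
    then show "(G (x, s), G (x, t)) \<in> B \<or> G (x, s) = G (x, t)"
      using close[OF that that _ p_range[OF that] p_range[OF that] p_time]
      by (simp add: G_def interval_adj_def)
  qed
  moreover have "digitally_continuous X A Y B (\<lambda>x. G (x, t))" if "t \<in> {0..k * n}" for t
    unfolding digitally_continuous_def
  proof (intro conjI ballI impI)
    show "(\<lambda>x. G (x, t)) \<in> X \<rightarrow> Y"
      using HY p_range that by (auto simp: G_def)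
    fix x y assume "x \<in> X" "y \<in> X" "(x, y) \<in> A"
    then show "(G (x, t), G (y, t)) \<in> B \<or> G (x, t) = G (y, t)"
      using close[OF _ _ _ p_range p_range p_space] that by (simp add: G_def)
  qed
  ultimately have "is_homotopy X A Y B f g (k * n) G"
    using k n ends p_start p_end by (simp add: is_homotopy_def G_def)
  moreover have "punctuated X (k * n) G"
    unfolding punctuated_def
  proof
    fix t
    \<comment> \<open>The moving point has the unique offset in \<open>{0..<n}\<close> for which
      \<open>n\<close> divides \<open>t + 1 + c y\<close>.\<close>
    obtain y where y: "y \<in> X" "c y = (- (t + 1)) mod n"
      using c_surj[of "(- (t + 1)) mod n"] n by auto
    have "G (x, t) = G (x, t + 1)" if x: "x \<in> X" "x \<noteq> y" for x
    proof -
      have "\<not> n dvd (t + c x) + 1"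
      proof
        assume "n dvd (t + c x) + 1"
        then have "c x mod n = (- (t + 1)) mod n"
          by (simp add: mod_eq_dvd_iff algebra_simps)
        \<comment> \<open>As \<open>0 \<le> c x < n\<close>, the offset is its own residue.\<close>
        then have "c x = c y"
          using c[OF x(1)] y(2) by simp
        then show False
          using c_inj x y(1) by blast
      qed
      then have "p x (t + 1) = p x t"
        using div_add_one_eq[OF n, of "t + c x"] by (simp add: p_def algebra_simps)
      then show ?thesis
        by (simp add: G_def)
    qed
    then show "\<exists>x\<^sub>t\<in>X. \<forall>x\<in>X. x \<noteq> x\<^sub>t \<longrightarrow> G (x, t) = G (x, t + 1)"
      using y(1) by blast
  qed
  ultimately show ?thesis
    by blast
qed

end
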